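(* Let $G$ be a weighted graph and let $b$ be an unlooped vertex of degree one whose unique neighbor is the vertex $a\neq b$. Let $G'$ be the weighted graph obtained from $G-b$ by changing the weights of $a$ to \[ \alpha'(a)=\alpha(a)\beta(b),\qquad \beta'(a)=\alpha(a)\alpha(b)(x-1)^{2}+\beta(a)\alpha(b)(y-1)+\beta(a)\beta(b), \] all other vertices keeping their weights. Then $q(G)=q(G')$.
   Context: All graphs are finite and may have loops (at most one per vertex) but no multiple edges. The adjacency matrix of a graph is the symmetric $0/1$ matrix over $GF(2)$ whose diagonal entry at $v$ is $1$ iff $v$ is looped; $r(G)$ and $n(G)$ denote its rank and nullity over $GF(2)$ (the empty graph has $r=n=0$). For $S\subseteq V(G)$, $G[S]$ is the induced subgraph. Let $A$ be a commutative ring with unity containing elements $x,y$. A weighted graph is a graph $G$ together with functions $\alpha,\beta:V(G)\to A$, and its weighted interlace polynomial is \[ q(G)=\sum_{S\subseteq V(G)}\Big(\prod_{s\in S}\alpha(s)\Big)\Big(\prod_{v\notin S}\beta(v)\Big)(x-1)^{r(G[S])}(y-1)^{n(G[S])}. \] *)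

theory Defs
  imports
    "HOL-Library.Z2"
    "Jordan_Normal_Form.DL_Rank"
    "Jordan_Normal_Form.Matrix_Kernel"
begin

text \<open>
  An edge is the set of its endpoints, so a loop at \<open>v\<close> is the singleton \<open>{v}\<close>. Since the edges
  form a set, there are no multiple edges and at most one loop at each vertex.
\<close>

record 'v lgraph =
  verts :: "'v set"
  edges :: "'v set set"

definition graph :: "('v, 'z) lgraph_scheme \<Rightarrow> bool" where
  "graph G \<longleftrightarrow> finite (verts G) \<and> (\<forall>e\<in>edges G. \<exists>u\<in>verts G. \<exists>v\<in>verts G. e = {u, v})"

definition adjacent :: "('v, 'z) lgraph_scheme \<Rightarrow> 'v \<Rightarrow> 'v \<Rightarrow> bool" where
  "adjacent G u v \<longleftrightarrow> {u, v} \<in> edges G"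

abbreviation looped :: "('v, 'z) lgraph_scheme \<Rightarrow> 'v \<Rightarrow> bool" where
  "looped G v \<equiv> adjacent G v v"

definition neighbors :: "('v, 'z) lgraph_scheme \<Rightarrow> 'v \<Rightarrow> 'v set" where
  "neighbors G v = {u \<in> verts G. adjacent G v u}"

text \<open>A loop contributes two to the degree.\<close>

definition vdegree :: "('v, 'z) lgraph_scheme \<Rightarrow> 'v \<Rightarrow> nat" where
  "vdegree G v = card {e \<in> edges G. v \<in> e} + (if looped G v then 1 else 0)"

text \<open>The extra fields of a scheme, such as vertex weights, are kept unchanged.\<close>

definition induced :: "('v, 'z) lgraph_scheme \<Rightarrow> 'v set \<Rightarrow> ('v, 'z) lgraph_scheme" where
  "induced G S = G\<lparr>verts := verts G \<inter> S, edges := {e \<in> edges G. e \<subseteq> S}\<rparr>"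

definition delete_vertex :: "('v, 'z) lgraph_scheme \<Rightarrow> 'v \<Rightarrow> ('v, 'z) lgraph_scheme" where
  "delete_vertex G v = induced G (verts G - {v})"

text \<open>
  Matrices are indexed by numbers below the dimension, so the vertices are listed in an arbitrary
  order. Another order conjugates the adjacency matrix by a permutation matrix, which changes
  neither its rank nor its nullity.
\<close>

definition vertex_list :: "('v, 'z) lgraph_scheme \<Rightarrow> 'v list" where
  "vertex_list G = (SOME vs. distinct vs \<and> set vs = verts G)"

definition adjacency_matrix :: "('v, 'z) lgraph_scheme \<Rightarrow> bit mat" where
  "adjacency_matrix G =
    mat (card (verts G)) (card (verts G))
      (\<lambda>(i, j). if adjacent G (vertex_list G ! i) (vertex_list G ! j) then 1 else 0)"

definition graph_rank :: "('v, 'z) lgraph_scheme \<Rightarrow> nat" where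
  "graph_rank G = vec_space.rank (card (verts G)) (adjacency_matrix G)"

definition graph_nullity :: "('v, 'z) lgraph_scheme \<Rightarrow> nat" where
  "graph_nullity G = kernel_dim (adjacency_matrix G)"

record ('v, 'a) wgraph = "'v lgraph" +
  alpha :: "'v \<Rightarrow> 'a"
  beta :: "'v \<Rightarrow> 'a"

text \<open>
  The sort of \<open>'a\<close> is that of commutative rings with unity; unlike \<open>comm_ring_1\<close>, it does not
  exclude the zero ring.
\<close>

definition interlace_poly ::
    "'a::{comm_ring, comm_monoid_mult} \<Rightarrow> 'a \<Rightarrow> ('v, 'a) wgraph \<Rightarrow> 'a" where
  "interlace_poly x y G =
    (\<Sum>S\<in>Pow (verts G).
      (\<Prod>s\<in>S. alpha G s) * (\<Prod>v\<in>verts G - S. beta G v) *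
      (x - 1) ^ graph_rank (induced G S) * (y - 1) ^ graph_nullity (induced G S))"

end

theory Submission
  imports Defs
begin

text \<open>
  Since \<open>GF(2)\<close> has two elements, the kernel of an adjacency matrix has \<open>2\<^sup>n\<close> elements, where \<open>n\<close> is
  the nullity, and the rank is the number of vertices minus \<open>n\<close>. Hence counting kernels suffices: for
  \<open>S\<close> avoiding \<open>a\<close> and \<open>b\<close>, adding the isolated vertex \<open>b\<close> to \<open>G[S]\<close> raises the nullity by one, and
  adding both \<open>a\<close> and \<open>b\<close> leaves it unchanged and so raises the rank by two. The terms of \<open>q(G)\<close> for
  \<open>S\<close>, \<open>S \<union> {b}\<close> and \<open>S \<union> {a, b}\<close> therefore combine into the term of \<open>q(G')\<close> for \<open>S\<close>, and the term for
  \<open>S \<union> {a}\<close> agrees with that of \<open>q(G')\<close> for \<open>S \<union> {a}\<close>.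
\<close>

section \<open>Linear algebra\<close>

text \<open>Coordinates with respect to a finite basis \<open>B\<close> identify vectors with scalar
  functions on \<open>B\<close>. Extensional functions fix the values off \<open>B\<close>, so every
  vector has exactly one coefficient function and these can be counted.\<close>

lemma (in vectorspace) card_carrier_eq_power_dim:
  assumes "fin_dim"
  shows "card (carrier V) = card (carrier K) ^ dim"
proof -
  obtain B where B: "finite B" "basis B"
    using finite_basis_exists[OF assms] by auto
  then have BV: "B \<subseteq> carrier V"
    by (simp add: basis_def)
  have unique: "\<exists>!a. a \<in> B \<rightarrow>\<^sub>E carrier K \<and> lincomb a B = v" if "v \<in> carrier V" for v
    using basis_criterion[OF B(1) BV] B(2) that by blast
  have closed: "lincomb a B \<in> carrier V" if "a \<in> B \<rightarrow>\<^sub>E carrier K" for a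
    using that BV by (intro lincomb_closed) auto
  have "bij_betw (\<lambda>a. lincomb a B) (B \<rightarrow>\<^sub>E carrier K) (carrier V)"
    unfolding bij_betw_def inj_on_def using unique closed by (auto simp: image_iff) metis+
  then have "card (carrier V) = card (B \<rightarrow>\<^sub>E carrier K)"
    by (simp add: bij_betw_same_card)
  also have "\<dots> = card (carrier K) ^ dim"
    by (simp add: card_PiE B(1) dim_basis[OF B])
  finally show ?thesis .
qed

lemma finite_carrier_vec:
  assumes "finite (UNIV :: 'a set)"
  shows "finite (carrier_vec n :: 'a vec set)"
proof -
  have "carrier_vec n \<subseteq> vec_of_list ` {xs :: 'a list. set xs \<subseteq> UNIV \<and> length xs = n}"
  proof
    fix v :: "'a vec"
    assume "v \<in> carrier_vec n"
    then show "v \<in> vec_of_list ` {xs. set xs \<subseteq> UNIV \<and> length xs = n}"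
      by (intro image_eqI[of _ _ "list_of_vec v"]) (auto simp: vec_list)
  qed
  then show ?thesis
    using finite_lists_length_eq[OF assms] finite_surj by blast
qed

lemma card_mat_kernel:
  fixes A :: "'a::field mat"
  assumes "A \<in> carrier_mat nr nc" and fin: "finite (UNIV :: 'a set)"
  shows "card (mat_kernel A) = card (UNIV :: 'a set) ^ kernel_dim A"
proof -
  interpret kernel nr nc A
    by unfold_locales (rule assms(1))
  have "finite (mat_kernel A)"
    using finite_subset[OF mat_kernel_carrier[OF assms(1)] finite_carrier_vec[OF fin]] .
  \<comment> \<open>Over a finite field the kernel is a finite set, so it can serve as its own
    finite spanning set; this gives finite dimension.\<close>
  moreover have "Ker.span (mat_kernel A) = mat_kernel A"
    using Ker.in_own_span[of "mat_kernel A"] Ker.span_is_subset2[of "mat_kernel A"] by auto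
  ultimately have "Ker.fin_dim"
    unfolding Ker.fin_dim_def by auto
  from Ker.card_carrier_eq_power_dim[OF this] show ?thesis
    by simp
qed

text \<open>This is rank-nullity for the linear map \<open>v \<mapsto> A *\<^sub>v v\<close>: its
  image is the column space, and its kernel is \<open>mat_kernel A\<close>.\<close>

lemma rank_plus_kernel_dim:
  fixes A :: "'a::field mat"
  assumes A: "A \<in> carrier_mat nr nc"
  shows "vec_space.rank nr A + kernel_dim A = nc"
proof -
  interpret K: kernel nr nc A
    by unfold_locales (rule A)
  interpret R: vec_space "TYPE('a)" nr .
  have hom: "(*\<^sub>v) A \<in> LinearCombinations.module_hom class_ring K.NC.V R.V"
    using A unfolding LinearCombinations.module_hom_def
    by (auto simp: module_vec_simps mult_add_distrib_mat_vec mult_mat_vec class_ring_simps)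
  interpret L: linear_map class_ring K.NC.V R.V "(*\<^sub>v) A"
    by unfold_locales (rule hom)
  have im: "L.im = R.span (set (cols A))"
    using R.col_space_eq[OF A] A unfolding R.col_space_def L.im_def
    by (auto simp: module_vec_simps)
  have ker: "L.ker = mat_kernel A"
    unfolding L.ker_def mat_kernel[OF A] by (auto simp: module_vec_simps)
  show ?thesis
    using L.rank_nullity[OF K.NC.fin_dim] unfolding im ker R.rank_def K.kernel_dim K.NC.dim_is_n
    by simp
qed

section \<open>Rank and nullity of induced subgraphs\<close>

lemma verts_induced [simp]: "verts (induced G S) = verts G \<inter> S"
  by (simp add: induced_def)

lemma adjacent_induced [simp]:
  "adjacent (induced G S) u v \<longleftrightarrow> adjacent G u v \<and> u \<in> S \<and> v \<in> S"
  by (auto simp: induced_def adjacent_def)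

lemma adjacent_commute: "adjacent G u v \<longleftrightarrow> adjacent G v u"
  by (simp add: adjacent_def insert_commute)

text \<open>The indicator vectors of these sets are the kernel of the adjacency matrix of \<open>G[S]\<close>.\<close>

definition even_subsets :: "('v, 'z) lgraph_scheme \<Rightarrow> 'v set \<Rightarrow> 'v set set" where
  "even_subsets G S = {T. T \<subseteq> S \<and> (\<forall>u\<in>S. even (card {v \<in> T. adjacent G u v}))}"

lemma UNIV_bit: "(UNIV :: bit set) = {0, 1}"
  by (auto intro: bit_not_zero_iff[THEN iffD1])

lemma of_nat_bit_eq_0_iff: "(of_nat n :: bit) = 0 \<longleftrightarrow> even n"
  by (induction n) auto

lemma vertex_list:
  assumes "finite (verts G)"
  shows "distinct (vertex_list G)" "set (vertex_list G) = verts G"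
    "length (vertex_list G) = card (verts G)"
proof -
  have "distinct (vertex_list G) \<and> set (vertex_list G) = verts G"
    unfolding vertex_list_def by (rule someI_ex) (use finite_distinct_list[OF assms] in blast)
  then show "distinct (vertex_list G)" "set (vertex_list G) = verts G"
    "length (vertex_list G) = card (verts G)"
    using distinct_card by fastforce+
qed

lemma adjacency_matrix_carrier:
  "adjacency_matrix G \<in> carrier_mat (card (verts G)) (card (verts G))"
  by (simp add: adjacency_matrix_def)

lemma graph_rank_plus_nullity: "graph_rank G + graph_nullity G = card (verts G)"
  unfolding graph_rank_def graph_nullity_def
  by (rule rank_plus_kernel_dim[OF adjacency_matrix_carrier])

text \<open>Over GF(2) a vector is the indicator of its support. Applying the adjacency matrix to
  the indicator of \<open>T\<close> gives at each vertex the parity of its number of neighbors in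
  \<open>T\<close>, so even subsets correspond to kernel vectors.\<close>

lemma card_even_subsets_verts:
  assumes fin: "finite (verts G)"
  shows "card (even_subsets G (verts G)) = 2 ^ graph_nullity G"
proof -
  define n where "n = card (verts G)"
  define vs where "vs = vertex_list G"
  define A where "A = adjacency_matrix G"
  define chi :: "'a set \<Rightarrow> bit vec" where "chi T = vec n (\<lambda>i. of_bool (vs ! i \<in> T))" for T
  have vs: "distinct vs" "set vs = verts G" "length vs = n"
    using vertex_list[OF fin] by (auto simp: vs_def n_def)
  have A: "A \<in> carrier_mat n n"
    using adjacency_matrix_carrier by (auto simp: A_def n_def)
  have bij: "bij_betw ((!) vs) {..<n} (verts G)"
    using bij_betw_nth[OF vs(1)] vs by auto
  \<comment> \<open>The matrix product sums over positions in \<open>vs\<close>; the bijection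
    \<open>bij\<close> turns this into a sum over vertices, which no longer depends on the chosen
    order.\<close>
  have entry: "(A *\<^sub>v chi T) $ i = of_nat (card {v \<in> T. adjacent G (vs ! i) v})"
    if "i < n" and T: "T \<subseteq> verts G" for i T
  proof -
    have "(A *\<^sub>v chi T) $ i
        = (\<Sum>j<n. of_bool (adjacent G (vs ! i) (vs ! j) \<and> vs ! j \<in> T))"
      using that A
      by (auto simp: A_def adjacency_matrix_def chi_def scalar_prod_def n_def[symmetric]
          vs_def[symmetric] atLeast0LessThan intro!: arg_cong[of _ _ card] arg_cong[of _ _ of_nat])
    also have "\<dots> = (\<Sum>v\<in>verts G. of_bool (adjacent G (vs ! i) v \<and> v \<in> T))"
      using sum.reindex_bij_betw[OF bij, of "\<lambda>v. of_bool (adjacent G (vs ! i) v \<and> v \<in> T) :: bit"] .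
    also have "\<dots> = of_nat (card (verts G \<inter> {v. adjacent G (vs ! i) v \<and> v \<in> T}))"
      using fin by (simp only: sum_of_bool_eq)
    also have "verts G \<inter> {v. adjacent G (vs ! i) v \<and> v \<in> T} = {v \<in> T. adjacent G (vs ! i) v}"
      using T by auto
    finally show ?thesis .
  qed
  have kernel_iff: "chi T \<in> mat_kernel A \<longleftrightarrow> T \<in> even_subsets G (verts G)"
    if T: "T \<subseteq> verts G" for T
  proof -
    have "chi T \<in> mat_kernel A \<longleftrightarrow> A *\<^sub>v chi T = 0\<^sub>v n"
      unfolding mat_kernel[OF A] by (simp add: chi_def)
    also have "\<dots> \<longleftrightarrow> (\<forall>i<n. (A *\<^sub>v chi T) $ i = 0)"
      using A by (auto simp: vec_eq_iff)
    also have "\<dots> \<longleftrightarrow> (\<forall>i<n. even (card {v \<in> T. adjacent G (vs ! i) v}))"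
      using entry[OF _ T] by (simp add: of_nat_bit_eq_0_iff)
    also have "\<dots> \<longleftrightarrow> (\<forall>u\<in>verts G. even (card {v \<in> T. adjacent G u v}))"
      using vs by (metis in_set_conv_nth)
    finally show ?thesis
      using T by (simp add: even_subsets_def)
  qed
  have "bij_betw chi (even_subsets G (verts G)) (mat_kernel A)"
  proof (rule bij_betw_imageI)
    show "inj_on chi (even_subsets G (verts G))"
    proof (rule inj_onI)
      fix S T
      assume ST: "S \<in> even_subsets G (verts G)" "T \<in> even_subsets G (verts G)" and "chi S = chi T"
      then have "vs ! i \<in> S \<longleftrightarrow> vs ! i \<in> T" if "i < n" for i
        using that by (auto simp: chi_def vec_eq_iff of_bool_eq_iff)
      then have "v \<in> S \<longleftrightarrow> v \<in> T" if "v \<in> verts G" for v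
        using that vs by (metis in_set_conv_nth)
      then show "S = T"
        using ST by (auto simp: even_subsets_def)
    qed
    show "chi ` even_subsets G (verts G) = mat_kernel A"
    proof
      show "chi ` even_subsets G (verts G) \<subseteq> mat_kernel A"
        using kernel_iff by (auto simp: even_subsets_def)
      show "mat_kernel A \<subseteq> chi ` even_subsets G (verts G)"
      proof
        fix w
        assume w: "w \<in> mat_kernel A"
        \<comment> \<open>The preimage of \<open>w\<close> is its support, read as a set of
          vertices.\<close>
        define T where "T = (!) vs ` {i. i < n \<and> w $ i = 1}"
        have "T \<subseteq> verts G"
          unfolding T_def vs(2)[symmetric] using vs(3) by auto
        moreover have "chi T = w"
        proof (rule eq_vecI)
          show "dim_vec (chi T) = dim_vec w"
            using mat_kernelD(1)[OF A w] by (simp add: chi_def)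
          fix i
          assume "i < dim_vec w"
          then have i: "i < n"
            using mat_kernelD(1)[OF A w] by simp
          \<comment> \<open>Since \<open>vs\<close> is distinct, no other position can put
            \<open>vs ! i\<close> into \<open>T\<close>.\<close>
          then have "vs ! i \<in> T \<longleftrightarrow> w $ i = 1"
            using vs by (auto simp: T_def nth_eq_iff_index_eq)
          with i show "chi T $ i = w $ i"
            by (cases "w $ i = 1") (simp_all add: chi_def)
        qed
        ultimately show "w \<in> chi ` even_subsets G (verts G)"
          using kernel_iff w by blast
      qed
    qed
  qed
  then have "card (even_subsets G (verts G)) = card (UNIV :: bit set) ^ kernel_dim A"
    using card_mat_kernel[OF A] by (simp add: bij_betw_same_card UNIV_bit)
  then show ?thesis
    by (simp add: A_def graph_nullity_def UNIV_bit numeral_2_eq_2)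
qed

text \<open>The parity conditions involve only pairs of vertices in \<open>S\<close>, for which
  adjacency in \<open>G\<close> and in the induced subgraph agree.\<close>

lemma card_even_subsets:
  assumes "finite S" "S \<subseteq> verts G"
  shows "card (even_subsets G S) = 2 ^ graph_nullity (induced G S)"
proof -
  have "even_subsets G S = even_subsets (induced G S) (verts (induced G S))"
    using assms(2) unfolding even_subsets_def
    by (auto simp: Int_absorb1 intro!: arg_cong[of _ _ "\<lambda>X. even (card X)"])
      (auto simp: subset_iff cong: conj_cong)
  then show ?thesis
    using card_even_subsets_verts[of "induced G S"] assms by simp
qed

lemma graph_rank_induced_plus_nullity:
  "S \<subseteq> verts G \<Longrightarrow> graph_rank (induced G S) + graph_nullity (induced G S) = card S"
  using graph_rank_plus_nullity[of "induced G S"] by (simp add: Int_absorb1)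

text \<open>The family \<open>even_subsets G S\<close> sees only adjacency within \<open>S\<close>,
  so its cardinality determines the nullity, and \<open>card S\<close> then determines the rank.
  This will transfer exponents between \<open>G\<close> and \<open>G'\<close>.\<close>

lemma induced_cong:
  assumes "finite S" "S \<subseteq> verts G" "S \<subseteq> verts H"
    and "\<And>u v. u \<in> S \<Longrightarrow> v \<in> S \<Longrightarrow> adjacent G u v \<longleftrightarrow> adjacent H u v"
  shows "graph_nullity (induced G S) = graph_nullity (induced H S)"
    and "graph_rank (induced G S) = graph_rank (induced H S)"
proof -
  have "{v \<in> T. adjacent G u v} = {v \<in> T. adjacent H u v}" if "T \<subseteq> S" "u \<in> S" for T u
    using assms(4) that by auto
  then have "even_subsets G S = even_subsets H S"
    unfolding even_subsets_def by auto
  then have "(2::nat) ^ graph_nullity (induced G S) = 2 ^ graph_nullity (induced H S)"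
    using card_even_subsets assms(1-3) by metis
  then show *: "graph_nullity (induced G S) = graph_nullity (induced H S)"
    by simp
  show "graph_rank (induced G S) = graph_rank (induced H S)"
    using graph_rank_induced_plus_nullity[OF assms(2)] graph_rank_induced_plus_nullity[OF assms(3)] *
    by simp
qed

text \<open>Membership of \<open>b\<close> affects no parity, and the condition at \<open>b\<close>
  itself counts an empty set. Each even subset of \<open>S\<close> therefore extends in two ways;
  the doubling adds one to the nullity, which absorbs the extra vertex and leaves the rank as it
  was.\<close>

lemma insert_isolated:
  assumes fin: "finite S" and sub: "insert b S \<subseteq> verts G" and b: "b \<notin> S"
    and iso: "\<And>u. u \<in> insert b S \<Longrightarrow> \<not> adjacent G b u"
  shows "graph_nullity (induced G (insert b S)) = Suc (graph_nullity (induced G S))"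
    and "graph_rank (induced G (insert b S)) = graph_rank (induced G S)"
proof -
  let ?E = "even_subsets G S"
  have notin: "\<forall>T\<in>?E. b \<notin> T"
    using b by (auto simp: even_subsets_def)
  have N_b: "{v \<in> T. adjacent G b v} = {}" if "T \<subseteq> insert b S" for T
    using iso that by auto
  have "T \<in> even_subsets G (insert b S) \<longleftrightarrow> T - {b} \<in> ?E" for T
  proof -
    have "{v \<in> T. adjacent G u v} = {v \<in> T - {b}. adjacent G u v}" if "u \<in> S" for u
      using iso that adjacent_commute[of G u b] by auto
    moreover have "even (card {v \<in> T. adjacent G b v})" if "T \<subseteq> insert b S"
      unfolding N_b[OF that] by simp
    moreover have "T \<subseteq> insert b S \<longleftrightarrow> T - {b} \<subseteq> S"
      by auto
    ultimately show ?thesis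
      unfolding even_subsets_def by auto
  qed
  then have "even_subsets G (insert b S) = {T. T - {b} \<in> ?E}"
    by auto
  also have "\<dots> = ?E \<union> insert b ` ?E"
  proof -
    have "T \<in> ?E \<union> insert b ` ?E" if "T - {b} \<in> ?E" for T
      using that by (cases "b \<in> T") (auto simp: image_iff intro!: bexI[of _ "T - {b}"])
    with notin show ?thesis
      by (auto simp: image_iff)
  qed
  finally have split: "even_subsets G (insert b S) = ?E \<union> insert b ` ?E" .
  have finE: "finite ?E"
    by (rule finite_subset[of _ "Pow S"]) (auto simp: even_subsets_def fin)
  have "inj_on (insert b) ?E"
    using notin by (metis inj_onI insert_ident)
  moreover have "?E \<inter> insert b ` ?E = {}"
    using notin by auto
  ultimately have "card (even_subsets G (insert b S)) = 2 * card ?E"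
    using finE by (simp add: split card_Un_disjoint card_image)
  then have "(2::nat) ^ graph_nullity (induced G (insert b S)) = 2 ^ Suc (graph_nullity (induced G S))"
    using card_even_subsets fin sub by (metis finite_insert insert_subset power_Suc)
  then show *: "graph_nullity (induced G (insert b S)) = Suc (graph_nullity (induced G S))"
    by (simp only: power_inject_exp)
  show "graph_rank (induced G (insert b S)) = graph_rank (induced G S)"
    using graph_rank_induced_plus_nullity[of S G] graph_rank_induced_plus_nullity[OF sub] * fin sub b
    by simp
qed

text \<open>
  For an even subset of \<open>G[S \<union> {a, b}]\<close>, the condition at \<open>b\<close> excludes \<open>a\<close>, and the condition at
  \<open>a\<close> decides whether \<open>b\<close> belongs to it.
\<close>

lemma insert_pendant_edge:
  assumes fin: "finite S" and sub: "insert a (insert b S) \<subseteq> verts G"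
    and notin: "a \<notin> S" "b \<notin> S" "a \<noteq> b"
    and nbr: "\<And>u. u \<in> insert a (insert b S) \<Longrightarrow> adjacent G b u \<longleftrightarrow> u = a"
  shows "graph_nullity (induced G (insert a (insert b S))) = graph_nullity (induced G S)"
    and "graph_rank (induced G (insert a (insert b S))) = graph_rank (induced G S) + 2"
proof -
  let ?S = "insert a (insert b S)"
  have finT: "finite T" if "T \<subseteq> ?S" for T
    using that fin finite_subset by blast
  have N_b: "{v \<in> T. adjacent G b v} = T \<inter> {a}" if "T \<subseteq> ?S" for T
    using nbr that by auto
  have N_S: "{v \<in> T. adjacent G u v} = {v \<in> T - {b}. adjacent G u v}" if "u \<in> S" for u T
    using nbr[of u] that notin adjacent_commute[of G u b] by auto
  have ab: "adjacent G a b"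
    using nbr[of a] adjacent_commute[of G a b] by auto
  have N_a: "{v \<in> insert b T. adjacent G a v} = insert b {v \<in> T. adjacent G a v}" for T
    using ab by auto
  have even_iff: "T \<in> even_subsets G ?S \<longleftrightarrow>
      T - {b} \<in> even_subsets G S \<and> even (card {v \<in> T. adjacent G a v})" for T
  proof
    assume T: "T \<in> even_subsets G ?S"
    then have "even (card (T \<inter> {a}))"
      using N_b[of T] by (auto simp: even_subsets_def)
    then have "a \<notin> T"
      by (cases "a \<in> T") auto
    then show "T - {b} \<in> even_subsets G S \<and> even (card {v \<in> T. adjacent G a v})"
      using T N_S[of _ T] by (auto simp: even_subsets_def)
  next
    \<comment> \<open>Here \<open>a \<notin> T\<close> comes from
      \<open>T - {b} \<subseteq> S\<close>, so the condition at \<open>b\<close> holds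
      trivially.\<close>
    assume T: "T - {b} \<in> even_subsets G S \<and> even (card {v \<in> T. adjacent G a v})"
    then have "T \<subseteq> ?S" "a \<notin> T"
      using notin by (auto simp: even_subsets_def)
    moreover from this have "even (card {v \<in> T. adjacent G b v})"
      by (simp only: N_b) simp
    ultimately show "T \<in> even_subsets G ?S"
      using T N_S[of _ T] by (simp add: even_subsets_def)
  qed
  \<comment> \<open>The inverse of removing \<open>b\<close>: as \<open>a\<close> and
    \<open>b\<close> are adjacent, inserting \<open>b\<close> flips the parity at \<open>a\<close>,
    so exactly one choice makes it even.\<close>
  define extend where
    "extend T = (if even (card {v \<in> T. adjacent G a v}) then T else insert b T)" for T
  have inE: "b \<notin> T \<and> finite T" if "T \<in> even_subsets G S" for T
    using that notin finT[of T] by (auto simp: even_subsets_def)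
  have "bij_betw (\<lambda>T. T - {b}) (even_subsets G ?S) (even_subsets G S)"
  proof (rule bij_betw_byWitness[where f' = extend])
    show "\<forall>T\<in>even_subsets G ?S. extend (T - {b}) = T"
    proof
      fix T
      assume "T \<in> even_subsets G ?S"
      then have T: "T - {b} \<in> even_subsets G S" "even (card {v \<in> T. adjacent G a v})"
        using even_iff by auto
      show "extend (T - {b}) = T"
      proof (cases "b \<in> T")
        case True
        then have "{v \<in> T. adjacent G a v} = insert b {v \<in> T - {b}. adjacent G a v}"
          using ab by auto
        then have "card {v \<in> T. adjacent G a v} = Suc (card {v \<in> T - {b}. adjacent G a v})"
          using inE[OF T(1)] by simp
        then show ?thesis
          using T True by (auto simp: extend_def)
      qed (use T in \<open>simp add: extend_def\<close>)
    qed
    show "\<forall>T\<in>even_subsets G S. extend T - {b} = T"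
      using inE by (auto simp: extend_def)
    show "(\<lambda>T. T - {b}) ` even_subsets G ?S \<subseteq> even_subsets G S"
      using even_iff by auto
    show "extend ` even_subsets G S \<subseteq> even_subsets G ?S"
    proof
      fix U
      assume "U \<in> extend ` even_subsets G S"
      then obtain T where T: "T \<in> even_subsets G S" "U = extend T"
        by auto
      then have "U - {b} = T"
        using inE by (auto simp: extend_def)
      moreover have "even (card {v \<in> U. adjacent G a v})"
      proof (cases "even (card {v \<in> T. adjacent G a v})")
        case False
        then have "U = insert b T"
          by (simp add: T(2) extend_def)
        then show ?thesis
          using False inE[OF T(1)] by (simp only: N_a) simp
      qed (simp add: T(2) extend_def)
      ultimately show "U \<in> even_subsets G ?S"
        using even_iff T by simp
    qed
  qed
  then have "card (even_subsets G ?S) = card (even_subsets G S)"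
    by (rule bij_betw_same_card)
  then have "(2::nat) ^ graph_nullity (induced G ?S) = 2 ^ graph_nullity (induced G S)"
    using card_even_subsets fin sub by (metis finite_insert insert_subset)
  then show *: "graph_nullity (induced G ?S) = graph_nullity (induced G S)"
    by simp
  show "graph_rank (induced G ?S) = graph_rank (induced G S) + 2"
    using graph_rank_induced_plus_nullity[of S G] graph_rank_induced_plus_nullity[OF sub] * fin sub notin
    by simp
qed

section \<open>The interlace polynomial\<close>

lemma sum_Pow_insert:
  fixes f :: "'v set \<Rightarrow> 'a::comm_monoid_add"
  assumes "finite A" "z \<notin> A"
  shows "(\<Sum>S\<in>Pow (insert z A). f S) = (\<Sum>S\<in>Pow A. f S + f (insert z S))"
proof -
  have "inj_on (insert z) (Pow A)"
  proof (rule inj_onI)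
    fix S T
    assume "S \<in> Pow A" "T \<in> Pow A" "insert z S = insert z T"
    moreover from this have "z \<notin> S" "z \<notin> T"
      using assms(2) by auto
    ultimately show "S = T"
      by (simp add: insert_ident)
  qed
  moreover have "Pow A \<inter> insert z ` Pow A = {}"
    using assms(2) by auto
  ultimately show ?thesis
    using assms(1) by (simp add: Pow_insert sum.union_disjoint sum.reindex sum.distrib)
qed

theorem theorem4:
  fixes G G' :: "('v, 'a::{comm_ring, comm_monoid_mult}) wgraph"
    and x y :: 'a
    and a b :: 'v
  assumes "graph G"
    and "b \<in> verts G"
    and "\<not> looped G b"
    and "vdegree G b = 1"
    and "neighbors G b = {a}"
    and "a \<noteq> b"
    and "G' = (delete_vertex G b)
      \<lparr>alpha := (alpha G)(a := alpha G a * beta G b),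
       beta := (beta G)(a := alpha G a * alpha G b * (x - 1)\<^sup>2
         + beta G a * alpha G b * (y - 1) + beta G a * beta G b)\<rparr>"
  shows "interlace_poly x y G = interlace_poly x y G'"
proof -
  define W where "W = verts G - {a, b}"
  define \<alpha> where "\<alpha> = alpha G"
  define \<beta> where "\<beta> = beta G"
  have W: "finite W" "a \<notin> W" "b \<notin> W"
    using assms(1) by (auto simp: W_def graph_def)
  have verts_G: "verts G = insert b (insert a W)"
    using assms(2,5) by (auto simp: W_def neighbors_def)
  have verts_G': "verts G' = insert a W"
    using assms(6,7) W verts_G by (auto simp: delete_vertex_def induced_def)
  have adj_b: "adjacent G b u \<longleftrightarrow> u = a" if "u \<in> verts G" for u
    using assms(5) that by (auto simp: neighbors_def)
  have adj_G': "adjacent G' u v \<longleftrightarrow> adjacent G u v" if "u \<in> insert a W" "v \<in> insert a W" for u v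
    using assms(6,7) that verts_G W by (auto simp: delete_vertex_def induced_def adjacent_def)
  have alpha_G': "alpha G' = \<alpha>(a := \<alpha> a * \<beta> b)"
    using assms(7) by (simp add: \<alpha>_def \<beta>_def)
  have beta_G': "beta G' = \<beta>(a := \<alpha> a * \<alpha> b * (x - 1)\<^sup>2 + \<beta> a * \<alpha> b * (y - 1) + \<beta> a * \<beta> b)"
    using assms(7) by (simp add: \<alpha>_def \<beta>_def)
  define t where "t S = (\<Prod>s\<in>S. alpha G s) * (\<Prod>v\<in>verts G - S. beta G v) *
      (x - 1) ^ graph_rank (induced G S) * (y - 1) ^ graph_nullity (induced G S)" for S
  define t' where "t' S = (\<Prod>s\<in>S. alpha G' s) * (\<Prod>v\<in>verts G' - S. beta G' v) *
      (x - 1) ^ graph_rank (induced G' S) * (y - 1) ^ graph_nullity (induced G' S)" for S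
  \<comment> \<open>For fixed \<open>S\<close>, the left side collects the four vertex sets of
    \<open>G\<close> that meet \<open>W\<close> in \<open>S\<close>, the right side the two such
    sets of \<open>G'\<close>.\<close>
  have "t S + t (insert a S) + (t (insert b S) + t (insert b (insert a S))) = t' S + t' (insert a S)"
    if S: "S \<subseteq> W" for S
  proof -
    have S': "finite S" "a \<notin> S" "b \<notin> S" "finite (W - S)" "a \<notin> W - S" "b \<notin> W - S"
      using S W finite_subset by auto
    have diffs: "verts G - S = insert b (insert a (W - S))"
      "verts G - insert a S = insert b (W - S)"
      "verts G - insert b S = insert a (W - S)"
      "verts G - insert b (insert a S) = W - S"
      "verts G' - S = insert a (W - S)"
      "verts G' - insert a S = W - S"
      using S W assms(6) by (auto simp: verts_G verts_G')
    \<comment> \<open>As \<open>a \<notin> S\<close>, the vertex \<open>b\<close> has lost its only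
      neighbor.\<close>
    have b_iso: "graph_nullity (induced G (insert b S)) = Suc (graph_nullity (induced G S))"
      "graph_rank (induced G (insert b S)) = graph_rank (induced G S)"
      using insert_isolated[of S b G] S S' verts_G adj_b assms(6) by auto
    have ab: "graph_nullity (induced G (insert b (insert a S))) = graph_nullity (induced G S)"
      "graph_rank (induced G (insert b (insert a S))) = graph_rank (induced G S) + 2"
      unfolding insert_commute[of b a]
      using insert_pendant_edge[of S a b G] S S' verts_G adj_b assms(6) by auto
    \<comment> \<open>Sets inside \<open>insert a S\<close> avoid \<open>b\<close>, so deleting
      \<open>b\<close> does not change the subgraphs they induce.\<close>
    have G': "graph_nullity (induced G' T) = graph_nullity (induced G T)"
      "graph_rank (induced G' T) = graph_rank (induced G T)" if "T \<subseteq> insert a S" for T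
    proof -
      have T: "finite T" "T \<subseteq> verts G'" "T \<subseteq> verts G"
        using that S S' finite_subset[of T "insert a S"] by (auto simp: verts_G verts_G')
      have "adjacent G' u v \<longleftrightarrow> adjacent G u v" if "u \<in> T" "v \<in> T" for u v
        using that T(2) adj_G'[of u v] unfolding verts_G' by auto
      from induced_cong[OF T this]
      show "graph_nullity (induced G' T) = graph_nullity (induced G T)"
        "graph_rank (induced G' T) = graph_rank (induced G T)" by auto
    qed
    define P where "P = prod \<alpha> S"
    define Q where "Q = prod \<beta> (W - S)"
    \<comment> \<open>The weights differ only at \<open>a\<close>, which lies in neither
      \<open>S\<close> nor \<open>W - S\<close>.\<close>
    have prods: "prod (alpha G') S = P" "prod (beta G') (W - S) = Q"
      unfolding P_def Q_def alpha_G' beta_G' using S' by (auto intro!: prod.cong)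
    let ?X = "(x - 1) ^ graph_rank (induced G S)" and ?Y = "(y - 1) ^ graph_nullity (induced G S)"
    \<comment> \<open>The exponents for \<open>insert a S\<close> need not be related to those for
      \<open>S\<close>: the same factor \<open>?Z\<close> occurs in \<open>t (insert a S)\<close>
      and in \<open>t' (insert a S)\<close>.\<close>
    let ?Z = "(x - 1) ^ graph_rank (induced G (insert a S)) *
      (y - 1) ^ graph_nullity (induced G (insert a S))"
    have "t S = P * (\<beta> b * (\<beta> a * Q)) * ?X * ?Y"
      using S' assms(6) by (simp add: t_def diffs P_def Q_def \<alpha>_def \<beta>_def)
    moreover have "t (insert a S) = (\<alpha> a * P) * (\<beta> b * Q) * ?Z"
      using S' assms(6) by (simp add: t_def diffs P_def Q_def \<alpha>_def \<beta>_def mult.assoc)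
    moreover have "t (insert b S) = (\<alpha> b * P) * (\<beta> a * Q) * ?X * ((y - 1) * ?Y)"
      using S' assms(6) by (simp add: t_def diffs P_def Q_def \<alpha>_def \<beta>_def b_iso)
    moreover have "t (insert b (insert a S)) = (\<alpha> b * (\<alpha> a * P)) * Q * (?X * (x - 1)\<^sup>2) * ?Y"
    proof -
      have "prod (alpha G) (insert b (insert a S)) = \<alpha> b * (\<alpha> a * P)"
        using S' assms(6) by (simp add: P_def \<alpha>_def)
      then show ?thesis
        by (simp only: t_def diffs ab power_add Q_def \<beta>_def)
    qed
    \<comment> \<open>The three summands of the new weight of \<open>a\<close> account, in order,
      for \<open>t (insert b (insert a S))\<close>, \<open>t (insert b S)\<close> and
      \<open>t S\<close>.\<close>
    moreover have "t' S = P * ((\<alpha> a * \<alpha> b * (x - 1)\<^sup>2 + \<beta> a * \<alpha> b * (y - 1) + \<beta> a * \<beta> b) * Q) * ?X * ?Y"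
      using S' G'[of S] by (simp add: t'_def diffs prods) (simp add: beta_G' subset_insertI)
    moreover have "t' (insert a S) = (\<alpha> a * \<beta> b * P) * Q * ?Z"
      using S' G'[of "insert a S"] by (simp add: t'_def diffs prods mult.assoc) (simp add: alpha_G' mult.assoc)
    ultimately show ?thesis
      by (simp only: distrib_left distrib_right ac_simps)
  qed
  then have "(\<Sum>S\<in>Pow W. t S + t (insert a S) + (t (insert b S) + t (insert b (insert a S))))
      = (\<Sum>S\<in>Pow W. t' S + t' (insert a S))"
    by (intro sum.cong) auto
  moreover have "interlace_poly x y G
      = (\<Sum>S\<in>Pow W. t S + t (insert a S) + (t (insert b S) + t (insert b (insert a S))))"
  proof -
    have "interlace_poly x y G = (\<Sum>S\<in>Pow (insert b (insert a W)). t S)"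
      unfolding interlace_poly_def t_def verts_G ..
    also have "\<dots> = (\<Sum>S\<in>Pow W. t S + t (insert a S) + (t (insert b S) + t (insert b (insert a S))))"
      using W assms(6) by (simp add: sum_Pow_insert ac_simps)
    finally show ?thesis .
  qed
  moreover have "interlace_poly x y G' = (\<Sum>S\<in>Pow W. t' S + t' (insert a S))"
  proof -
    have "interlace_poly x y G' = (\<Sum>S\<in>Pow (insert a W). t' S)"
      unfolding interlace_poly_def t'_def verts_G' ..
    also have "\<dots> = (\<Sum>S\<in>Pow W. t' S + t' (insert a S))"
      using W(1,2) by (rule sum_Pow_insert)
    finally show ?thesis .
  qed
  ultimately show ?thesis
    by simp
qed

end
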